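(* Let $\alpha$ be a badly approximable real number, i.e. $\inf_{q\ge 1} q\,\|q\alpha\|>0$. Then the set of real numbers $\beta$ such that $$\liminf_{q\to+\infty}\, q\,(\log q)^2\,\|q\alpha\|\,\|q\beta\|>0$$ (where $q$ runs over positive integers) has Hausdorff dimension $1$.
   Context: For a real number $x$, $\|x\|$ denotes the distance from $x$ to the nearest integer. *)

theory Defs
  imports "HOL-Analysis.Analysis"
begin

definition dist_nint :: "real \<Rightarrow> real" where
  "dist_nint x = \<bar>x - of_int (round x)\<bar>"

definition badly_approximable :: "real \<Rightarrow> bool" where
  "badly_approximable a \<longleftrightarrow> (INF q\<in>{1::nat..}. real q * dist_nint (real q * a)) > 0"

definition hausdorff_pre :: "real \<Rightarrow> real \<Rightarrow> 'a::metric_space set \<Rightarrow> ennreal" where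
  "hausdorff_pre s \<delta> E =
     (INF U\<in>{U::nat \<Rightarrow> 'a set. E \<subseteq> (\<Union>i. U i) \<and> (\<forall>i. bounded (U i) \<and> diameter (U i) \<le> \<delta>)}.
        (\<Sum>i. ennreal (diameter (U i) powr s)))"

definition hausdorff_measure :: "real \<Rightarrow> 'a::metric_space set \<Rightarrow> ennreal" where
  "hausdorff_measure s E = (SUP \<delta>\<in>{0<..}. hausdorff_pre s \<delta> E)"

text \<open>Hausdorff dimension: infimum of the positive s with H^s(E) = 0.
  (Restricting to s > 0 avoids the convention 0 powr 0 = 0.)\<close>
definition hausdorff_dim :: "'a::metric_space set \<Rightarrow> real" where
  "hausdorff_dim E = Inf {s::real. s > 0 \<and> hausdorff_measure s E = 0}"

end

theory Submission
  imports Defs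
begin

text \<open>Write \<open>w(q) = 1 / (q (log q)\<^sup>2 \<parallel>q\<alpha>\<parallel>)\<close>. Bad approximability separates the points \<open>q\<alpha>\<close>, so
  the sum of \<open>w(q)\<close> over \<open>2\<^sup>k \<le> q < 2\<^sup>k\<^sup>+\<^sup>1\<close> is \<open>O(1/k)\<close> and the sum over \<open>N \<le> q < N\<^sup>4\<close> is bounded by
  a constant. The lower bound on the dimension is the Peres--Schlag removal argument: starting from
  \<open>[0,1]\<close>, remove the sets \<open>\<parallel>q\<beta>\<parallel> < \<delta> w(q)\<close> in blocks \<open>n\<^sub>j \<le> q < n\<^sub>j\<^sub>+\<^sub>1 = n\<^sub>j\<^sup>4\<close>. What is left before
  the previous block has at most \<open>O(n\<^sub>j\<^sub>-\<^sub>1\<^sup>2)\<close> components, far fewer than \<open>n\<^sub>j\<close>, so the sets of the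
  current block occupy only a small proportion of it, and each block at most halves the measure.

  To get dimension 1 without constructing a measure, suppose that for some \<open>s < 1\<close> the set has a cover
  by balls whose radii have a small sum of \<open>s\<close>-th powers, and remove the balls of radius between
  \<open>1/n\<^sub>j\<^sub>+\<^sub>1\<close> and \<open>1/n\<^sub>j\<close> together with the \<open>j\<close>-th block. Their measure \<open>O(n\<^sub>j\<^sup>s\<^sup>-\<^sup>1)\<close> is negligible against
  \<open>2\<^sup>-\<^sup>j\<close>, so by compactness a point survives; it lies in the set but in no ball of the cover.\<close>

section \<open>Distance to the nearest integer and bad approximability\<close>

lemma dist_nint_le: "dist_nint x \<le> \<bar>x - of_int n\<bar>"
  unfolding dist_nint_def by (rule round_diff_minimal)

lemma dist_nint_less_iff: "dist_nint x < e \<longleftrightarrow> (\<exists>n::int. \<bar>x - of_int n\<bar> < e)"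
  using dist_nint_le[of x] unfolding dist_nint_def by (meson le_less_trans)

lemma dist_nint_nonneg [simp]: "0 \<le> dist_nint x"
  by (simp add: dist_nint_def)

lemma open_dist_nint_less: "open {x::real. dist_nint (a * x) < e}"
  unfolding dist_nint_less_iff
  by (intro open_Collect_ex open_Collect_less continuous_intros)

lemma badly_approximable_lower_bound:
  assumes "badly_approximable \<alpha>"
  obtains c where "c > 0" "\<And>q::nat. q \<ge> 1 \<Longrightarrow> c \<le> real q * dist_nint (real q * \<alpha>)"
proof
  let ?c = "INF q\<in>{1::nat..}. real q * dist_nint (real q * \<alpha>)"
  show "?c > 0" using assms by (simp add: badly_approximable_def)
  show "?c \<le> real q * dist_nint (real q * \<alpha>)" if "q \<ge> 1" for q
    using that by (intro cINF_lower bdd_belowI2[where m=0]) auto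
qed

section \<open>Sums of reciprocal distances of the multiples of \<alpha> from the integers\<close>

lemma harm_le_1_plus_ln: "n \<ge> 1 \<Longrightarrow> harm n \<le> 1 + ln (real n)"
  using decseqD[OF decseq_harm_diff_ln, of 0 "n - 1"] by (cases n) (auto simp: harm_expand)

text \<open>Each absolute value from 1 to \<open>K\<close> is taken by at most two integers.
  \<open>S\<close> will be the set of indices of the cells occupied by the points
  \<open>q\<alpha>\<close>.\<close>

lemma sum_inverse_abs_le_harm:
  fixes K :: nat
  assumes "finite S" "S \<subseteq> {- int K..int K} - {0}"
  shows "(\<Sum>k\<in>S. 1 / real_of_int \<bar>k\<bar>) \<le> 2 * harm K"
proof -
  have eq: "{- int K..int K} - {0} = int ` {1..K} \<union> (\<lambda>n. - int n) ` {1..K}" (is "_ = ?P \<union> ?N")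
  proof (intro equalityI subsetI)
    fix k assume k: "k \<in> {- int K..int K} - {0}"
    then have "k = int (nat k) \<and> nat k \<in> {1..K} \<or> k = - int (nat (- k)) \<and> nat (- k) \<in> {1..K}"
      by auto
    then show "k \<in> ?P \<union> ?N" by blast
  qed auto
  have "(\<Sum>k\<in>S. 1 / real_of_int \<bar>k\<bar>) \<le> (\<Sum>k\<in>?P \<union> ?N. 1 / real_of_int \<bar>k\<bar>)"
    using assms unfolding eq by (intro sum_mono2) auto
  also have "\<dots> = (\<Sum>k\<in>?P. 1 / real_of_int \<bar>k\<bar>) + (\<Sum>k\<in>?N. 1 / real_of_int \<bar>k\<bar>)"
    by (rule sum.union_disjoint) auto
  also have "(\<Sum>k\<in>?P. 1 / real_of_int \<bar>k\<bar>) = harm K"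
    by (subst sum.reindex) (auto simp: harm_def divide_inverse)
  also have "(\<Sum>k\<in>?N. 1 / real_of_int \<bar>k\<bar>) = harm K"
    by (subst sum.reindex) (auto simp: harm_def divide_inverse inj_on_def)
  finally show ?thesis by simp
qed

text \<open>For \<open>Q \<le> q < 2Q\<close> the points \<open>q\<alpha>\<close> are pairwise \<open>c/Q\<close>-separated modulo 1 and stay
  \<open>c/2Q\<close> away from 0, so the cells of length \<open>c/2Q\<close> contain at most one of them each.\<close>

lemma sum_inverse_dist_nint_le:
  fixes Q :: nat
  assumes c: "c > 0" "\<And>q::nat. q \<ge> 1 \<Longrightarrow> c \<le> real q * dist_nint (real q * \<alpha>)" and Q: "Q \<ge> 1"
  shows "(\<Sum>q\<in>{Q..<2*Q}. 1 / dist_nint (real q * \<alpha>))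
           \<le> 8 * real Q / c * harm (nat \<lceil>real Q / c\<rceil> + 1)"
proof -
  \<comment> \<open>\<open>K\<close> will bound the absolute values of the cell indices; the extra 1
    allows for the floor of a negative number.\<close>
  define K where "K = nat \<lceil>real Q / c\<rceil> + 1"
  define x where "x q = real q * \<alpha> - of_int (round (real q * \<alpha>))" for q :: nat
  define k where "k q = \<lfloor>x q * (2 * real Q / c)\<rfloor>" for q
  define D where "D = 2 * real Q / c"
  have D: "D > 0" using c Q by (simp add: D_def)
  have kd: "of_int (k q) \<le> x q * D" "x q * D < of_int (k q) + 1" for q
    unfolding k_def D_def by linarith+
  \<comment> \<open>Up to an integer, \<open>x q - x p\<close> is \<open>(q - p)\<alpha>\<close>
    with \<open>q - p \<le> Q\<close>. The resulting separation \<open>c/Q\<close> is two cell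
    lengths \<open>1/D\<close>.\<close>
  have sep: "\<bar>x p - x q\<bar> * D \<ge> 2" if "p < q" "q - p \<le> Q" for p q
  proof -
    have "c \<le> real (q - p) * dist_nint (real (q - p) * \<alpha>)" using c(2)[of "q - p"] that by simp
    also have "\<dots> \<le> real Q * \<bar>x p - x q\<bar>"
    proof (intro mult_mono)
      have "real (q - p) * \<alpha> - of_int (round (real q * \<alpha>) - round (real p * \<alpha>)) = x q - x p"
        using that by (simp add: x_def of_nat_diff algebra_simps)
      then show "dist_nint (real (q - p) * \<alpha>) \<le> \<bar>x p - x q\<bar>"
        using dist_nint_le[of "real (q - p) * \<alpha>" "round (real q * \<alpha>) - round (real p * \<alpha>)"] by simp
    qed (use that in auto)
    finally show ?thesis using c by (simp add: D_def field_simps)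
  qed
  have inj: "inj_on k {Q..<2*Q}"
  proof (rule linorder_inj_onI')
    fix p q assume "p \<in> {Q..<2*Q}" "q \<in> {Q..<2*Q}" "p < q"
    then have "\<bar>x p - x q\<bar> * D \<ge> 2" by (intro sep) auto
    then have "\<bar>x p * D - x q * D\<bar> \<ge> 2" using D by (simp add: left_diff_distrib[symmetric] abs_mult)
    then show "k p \<noteq> k q" using kd[of p] kd[of q] by (smt (verit))
  qed
  have one: "\<bar>x q\<bar> * D \<ge> 1" if "q \<in> {Q..<2*Q}" for q
  proof -
    have "c \<le> real q * \<bar>x q\<bar>" using c(2)[of q] that Q by (simp add: x_def dist_nint_def)
    also have "\<dots> \<le> 2 * real Q * \<bar>x q\<bar>" using that by (intro mult_right_mono) auto
    finally show ?thesis using c by (simp add: D_def field_simps)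
  qed
  have k0: "k q \<noteq> 0 \<and> 1 / dist_nint (real q * \<alpha>) \<le> 2 * D * (1 / real_of_int \<bar>k q\<bar>)"
    if "q \<in> {Q..<2*Q}" for q
  proof -
    have o: "\<bar>x q * D\<bar> \<ge> 1" using one[OF that] D by (simp add: abs_mult)
    have k0: "k q \<noteq> 0" using o kd[of q] by (smt (verit) of_int_0)
    \<comment> \<open>The floor enlarges the absolute value by less than 1, and 1 is at most
      \<open>\<bar>x q * D\<bar>\<close>; hence the factor 2.\<close>
    have "real_of_int \<bar>k q\<bar> \<le> 2 * \<bar>x q * D\<bar>" proof -
      have "real_of_int (k q) \<ge> 1 \<or> real_of_int (k q) \<le> - 1" using k0 by linarith
      then show ?thesis using o kd[of q] unfolding of_int_abs by linarith
    qed
    then have le: "real_of_int \<bar>k q\<bar> \<le> 2 * D * \<bar>x q\<bar>" using D by (simp add: abs_mult mult_ac)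
    have x: "\<bar>x q\<bar> > 0" using o by (cases "x q = 0") auto
    have kp: "real_of_int \<bar>k q\<bar> > 0" using k0 by simp
    have "1 / \<bar>x q\<bar> \<le> 2 * D * (1 / real_of_int \<bar>k q\<bar>)"
      using le x kp by (simp add: field_simps)
    then show ?thesis using k0 by (simp add: dist_nint_def x_def)
  qed
  have rng: "k ` {Q..<2*Q} \<subseteq> {- int K..int K} - {0}"
  proof (clarify, intro DiffI)
    fix q assume q: "q \<in> {Q..<2*Q}"
    have "\<bar>x q\<bar> \<le> 1/2" using of_int_round_abs_le[of "real q * \<alpha>"] by (simp add: x_def abs_minus_commute)
    then have "\<bar>x q\<bar> * D \<le> 1/2 * D" using D by (intro mult_right_mono) auto
    then have "\<bar>x q * D\<bar> \<le> real Q / c" using D c by (simp add: abs_mult D_def)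
    moreover have "real Q / c \<le> real K - 1" unfolding K_def by linarith
    ultimately show "k q \<in> {- int K..int K}" using kd[of q] by auto
    show "k q \<notin> {0}" using k0[OF q] by simp
  qed
  have "(\<Sum>q\<in>{Q..<2*Q}. 1 / dist_nint (real q * \<alpha>))
      \<le> (\<Sum>q\<in>{Q..<2*Q}. 2 * D * (1 / real_of_int \<bar>k q\<bar>))"
    using k0 by (intro sum_mono) auto
  also have "\<dots> = 2 * D * (\<Sum>k\<in>k ` {Q..<2*Q}. 1 / real_of_int \<bar>k\<bar>)"
    by (simp add: sum.reindex[OF inj] sum_distrib_left)
  also have "\<dots> \<le> 2 * D * (2 * harm K)"
    using D rng by (intro mult_left_mono sum_inverse_abs_le_harm) auto
  finally show ?thesis by (simp add: D_def K_def)
qed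

text \<open>On the block, \<open>q\<close> is at least \<open>2^k\<close> and \<open>ln q\<close> at
  least \<open>k ln 2\<close>, while the reciprocal distances sum to \<open>O(2^k k)\<close>. Of the
  two factors \<open>1/k\<close> from the squared logarithm, one is left.\<close>

lemma dyadic_sum_littlewood_weight_le:
  assumes "badly_approximable \<alpha>"
  obtains C where "C > 0"
    "\<And>k. k \<ge> 1 \<Longrightarrow> (\<Sum>q\<in>{2^k..<2^(k+1)::nat}.
        1 / (real q * (ln (real q))\<^sup>2 * dist_nint (real q * \<alpha>))) \<le> C / real k"
proof -
  obtain c where c: "c > 0" "\<And>q::nat. q \<ge> 1 \<Longrightarrow> c \<le> real q * dist_nint (real q * \<alpha>)"
    using badly_approximable_lower_bound[OF assms] by blast
  \<comment> \<open>\<open>K \<le> Q/c + 2 \<le> Q (1/c + 2)\<close> with \<open>Q = 2^k\<close>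
    will give \<open>ln K \<le> k ln 2 + L\<close>, hence
    \<open>harm K \<le> k (2 + L)\<close>.\<close>
  define L where "L = ln (1 / c + 2)"
  have L: "L > 0" unfolding L_def using c by (intro ln_gt_zero) (simp add: add_pos_pos)
  define C where "C = 8 / c * (2 + L) / (ln 2)\<^sup>2"
  show thesis
  proof
    show "C > 0" using c L by (simp add: C_def)
    fix k :: nat assume k: "k \<ge> 1"
    define Q :: nat where "Q = 2 ^ k"
    have Q: "Q \<ge> 1" by (simp add: Q_def)
    define K where "K = nat \<lceil>real Q / c\<rceil> + 1"
    have "real Q / c > 0" using Q c by simp
    then have "real K \<le> real Q / c + 2" unfolding K_def by linarith
    also have "\<dots> \<le> real Q * (1 / c + 2)" using Q by (simp add: algebra_simps)
    finally have "ln (real K) \<le> ln (real Q * (1 / c + 2))"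
      by (subst ln_le_cancel_iff) (use c Q in \<open>auto simp: K_def intro!: mult_pos_pos add_pos_pos\<close>)
    also have "\<dots> = real k * ln 2 + L"
    proof -
      have "1 / c + 2 > 0" using c by (simp add: add_pos_pos)
      then show ?thesis by (simp add: L_def Q_def ln_mult ln_realpow)
    qed
    also have "\<dots> \<le> real k * 1 + real k * L"
    proof (intro add_mono mult_left_mono)
      show "ln 2 \<le> (1::real)" using ln_le_minus_one[of "2::real"] by simp
      show "L \<le> real k * L" using k L by simp
    qed auto
    finally have "harm K \<le> 1 + (real k * 1 + real k * L)"
      using harm_le_1_plus_ln[of K] by (simp add: K_def)
    also have "\<dots> \<le> real k * (2 + L)" using k by (simp add: algebra_simps)
    finally have hK: "harm K \<le> real k * (2 + L)" .
    have "(\<Sum>q\<in>{2^k..<2^(k+1)}. 1 / (real q * (ln (real q))\<^sup>2 * dist_nint (real q * \<alpha>)))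
        \<le> (\<Sum>q\<in>{Q..<2*Q}. 1 / (real Q * (real k * ln 2)\<^sup>2) * (1 / dist_nint (real q * \<alpha>)))"
    proof -
      have rng: "{2^k..<2^(k+1)} = {Q..<2*Q}" by (simp add: Q_def)
      show ?thesis unfolding rng
      proof (rule sum_mono)
        fix q :: nat assume q': "q \<in> {Q..<2*Q}"
        have q1: "q \<ge> 1" using q' Q by simp
        have "dist_nint (real q * \<alpha>) \<noteq> 0" using c(1) c(2)[OF q1] by auto
        then have d: "dist_nint (real q * \<alpha>) > 0" by (simp add: less_le)
        have qr: "real q \<ge> 2 ^ k" using q' by (simp add: Q_def)
        have "ln (2 ^ k :: real) \<le> ln (real q)" using qr q1 by (subst ln_le_cancel_iff) auto
        then have ln: "real k * ln 2 \<le> ln (real q)" by (simp add: ln_realpow)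
        have le: "2 ^ k * (real k * ln 2)\<^sup>2 * dist_nint (real q * \<alpha>)
              \<le> real q * (ln (real q))\<^sup>2 * dist_nint (real q * \<alpha>)"
          using qr ln by (intro mult_right_mono mult_mono power_mono) auto
        have pos: "0 < 2 ^ k * (real k * ln 2)\<^sup>2 * dist_nint (real q * \<alpha>)" using k d by simp
        show "1 / (real q * (ln (real q))\<^sup>2 * dist_nint (real q * \<alpha>))
          \<le> 1 / (real Q * (real k * ln 2)\<^sup>2) * (1 / dist_nint (real q * \<alpha>))"
          using le_imp_inverse_le[OF le pos] by (simp add: Q_def inverse_eq_divide)
      qed
    qed
    also have "\<dots> = 1 / (real Q * (real k * ln 2)\<^sup>2) * (\<Sum>q\<in>{Q..<2*Q}. 1 / dist_nint (real q * \<alpha>))"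
      by (simp add: sum_distrib_left)
    also have "\<dots> \<le> 1 / (real Q * (real k * ln 2)\<^sup>2) * (8 * real Q / c * (real k * (2 + L)))"
    proof (intro mult_left_mono)
      have "8 * real Q / c * harm K \<le> 8 * real Q / c * (real k * (2 + L))"
        using hK c by (intro mult_left_mono) auto
      then show "(\<Sum>q\<in>{Q..<2*Q}. 1 / dist_nint (real q * \<alpha>)) \<le> 8 * real Q / c * (real k * (2 + L))"
        using sum_inverse_dist_nint_le[OF c Q] unfolding K_def by linarith
    qed auto
    also have "\<dots> = C / real k"
      using k c Q by (simp add: C_def field_simps power2_eq_square)
    finally show "(\<Sum>q\<in>{2^k..<2^(k+1)}. 1 / (real q * (ln (real q))\<^sup>2 * dist_nint (real q * \<alpha>)))
      \<le> C / real k" .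
  qed
qed

section \<open>Measure of a periodic set inside a finite union of intervals\<close>

lemma bounded_borel_fmeasurable:
  fixes S :: "'a::euclidean_space set"
  assumes "bounded S" "S \<in> sets borel"
  shows "S \<in> fmeasurable lborel"
  using assms emeasure_bounded_finite[of S] by (simp add: fmeasurable_def)

text \<open>The set on the left is periodic with period \<open>1/q\<close> and has density at most \<open>2e\<close>; only the cells
  \<open>[i/q, (i+1)/q)\<close> containing one of the \<open>2 |F|\<close> endpoints fail to lie inside or outside \<open>B\<close>.\<close>

lemma measure_dist_nint_less_Int_le:
  fixes F :: "(real \<times> real) set" and q :: nat
  assumes F: "finite F" and B: "B = {0..1} - (\<Union>(a,b)\<in>F. {a<..<b})" and q: "q \<ge> 1" and e: "e \<ge> 0"
  shows "measure lborel (B \<inter> {x. dist_nint (real q * x) < e})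
           \<le> 2 * e * (measure lborel B + 2 * real (card F) / real q)"
proof -
  define E where "E = {x. dist_nint (real q * x) < e}"
  define cell where "cell i = {real i / real q ..< real (i+1) / real q}" for i
  have cell_iff: "x \<in> cell i \<longleftrightarrow> \<lfloor>real q * x\<rfloor> = int i" for x i
    using q by (auto simp: cell_def field_simps floor_eq_iff)
  \<comment> \<open>Cells with index in \<open>G\<close> lie inside \<open>B\<close>; those with
    index in \<open>D\<close> are cut by its boundary.\<close>
  define G where "G = {i. i < q \<and> cell i \<subseteq> B}"
  define D where "D = {i. i < q \<and> cell i \<inter> B \<noteq> {} \<and> \<not> cell i \<subseteq> B}"
  have fin: "finite G" "finite D" by (auto simp: G_def D_def)
  have Bb: "B \<in> sets lborel" unfolding B using F by (auto intro!: sets.finite_UN)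
  have Bf: "B \<in> fmeasurable lborel"
    by (rule bounded_borel_fmeasurable) (use Bb in \<open>auto simp: B intro: bounded_subset[of "{0..1}"]\<close>)
  have Eb: "E \<in> sets lborel" using open_dist_nint_less by (simp add: E_def)
  have cellE: "measure lborel (cell i \<inter> E) \<le> 2 * e / real q" for i
  proof -
    \<comment> \<open>No integer lies strictly between \<open>i\<close> and \<open>i + 1\<close>, so
      \<open>q * x\<close> is within \<open>e\<close> of one of these two.\<close>
    have "cell i \<inter> E \<subseteq> {real i / q ..< (real i + e) / q} \<union> {(real i + 1 - e) / q <..< (real i + 1) / q}"
    proof
      fix x assume x: "x \<in> cell i \<inter> E"
      then obtain p :: int where p: "\<bar>real q * x - of_int p\<bar> < e"
        by (auto simp: E_def dist_nint_less_iff)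
      have x': "real i \<le> real q * x" "real q * x < real i + 1"
        using x q by (auto simp: cell_def field_simps)
      have "real_of_int p \<le> real i \<or> real_of_int p \<ge> real i + 1"
        by (cases "p \<le> int i") linarith+
      then have "real q * x < real i + e \<or> real i + 1 - e < real q * x" using p by linarith
      then show "x \<in> {real i / q ..< (real i + e) / q} \<union> {(real i + 1 - e) / q <..< (real i + 1) / q}"
        using x' q by (auto simp: field_simps)
    qed
    then have "measure lborel (cell i \<inter> E) \<le>
      measure lborel ({real i / q ..< (real i + e) / q} \<union> {(real i + 1 - e) / q <..< (real i + 1) / q})"
      by (rule measure_mono_fmeasurable)
         (use Eb in \<open>auto simp: cell_def intro!: bounded_borel_fmeasurable\<close>)
    also have "\<dots> \<le> measure lborel {real i / q ..< (real i + e) / q} +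
        measure lborel {(real i + 1 - e) / q <..< (real i + 1) / q}"
      by (rule measure_Un_le) auto
    also have "\<dots> = 2 * e / real q"
      using e q by (simp add: divide_right_mono diff_divide_distrib[symmetric])
    finally show ?thesis .
  qed
  have card_D: "card D \<le> 2 * card F"
  proof -
    let ?X = "fst ` F \<union> snd ` F"
    \<comment> \<open>If a cell contains \<open>x \<in> B\<close> and \<open>y \<notin> B\<close>,
      the interval of \<open>F\<close> around \<open>y\<close> misses \<open>x\<close>, so it has an
      endpoint between them and thus in the cell. The floor recovers the cell from that
      endpoint.\<close>
    have "D \<subseteq> (\<lambda>x. nat \<lfloor>real q * x\<rfloor>) ` ?X"
    proof
      fix i assume "i \<in> D"
      then obtain x y where x: "x \<in> cell i" "x \<in> B" and y: "y \<in> cell i" "y \<notin> B" and i: "i < q"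
        by (auto simp: D_def)
      have y01: "0 \<le> y" using y(1) by (auto simp: cell_def) (meson divide_nonneg_nonneg of_nat_0_le_iff order_trans)
      have "y < real (i+1) / real q" using y(1) by (auto simp: cell_def)
      also have "\<dots> \<le> 1" using i q by simp
      finally have "y \<in> {0..1}" using y01 by simp
      then obtain a b where ab: "(a,b) \<in> F" "a < y" "y < b" using y(2) by (auto simp: B)
      have nx: "x \<le> a \<or> b \<le> x" using x(2) ab(1) by (force simp: B)
      have "a \<in> cell i \<or> b \<in> cell i"
        using nx x(1) y(1) ab by (auto simp: cell_def)
      then obtain z where "z \<in> ?X" "z \<in> cell i" using ab(1) by force
      then show "i \<in> (\<lambda>x. nat \<lfloor>real q * x\<rfloor>) ` ?X"
        by (auto simp: cell_iff intro!: image_eqI[of _ _ z])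
    qed
    then have "card D \<le> card ?X" using F by (intro surj_card_le) auto
    also have "\<dots> \<le> card (fst ` F) + card (snd ` F)" by (rule card_Un_le)
    also have "\<dots> \<le> card F + card F" by (intro add_mono card_image_le F)
    finally show ?thesis by simp
  qed
  have disj: "pairwise (\<lambda>i j. disjnt (cell i) (cell j)) G"
    by (auto simp: pairwise_def disjnt_def cell_iff set_eq_iff)
  have "real (card G) / real q = (\<Sum>i\<in>G. measure lborel (cell i))"
    using q by (simp add: cell_def divide_right_mono diff_divide_distrib[symmetric])
  also have "\<dots> = measure lborel (\<Union>i\<in>G. cell i)"
    by (rule measure_UNION'[symmetric])
       (use fin disj in \<open>auto intro!: bounded_borel_fmeasurable, auto simp: cell_def\<close>)
  also have "\<dots> \<le> measure lborel B"
    by (rule measure_mono_fmeasurable) (use Bf in \<open>auto simp: G_def cell_def\<close>)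
  finally have card_G: "real (card G) / real q \<le> measure lborel B" .
  \<comment> \<open>The half-open cells with \<open>i < q\<close> cover only \<open>[0,1)\<close>;
    the point 1 is added separately and has measure 0.\<close>
  have "B \<inter> E \<subseteq> {1} \<union> (\<Union>i\<in>G \<union> D. cell i \<inter> E)"
  proof
    fix x assume x: "x \<in> B \<inter> E"
    then have x01: "0 \<le> x" "x \<le> 1" by (auto simp: B)
    show "x \<in> {1} \<union> (\<Union>i\<in>G \<union> D. cell i \<inter> E)"
    proof (cases "x = 1")
      case False
      define i where "i = nat \<lfloor>real q * x\<rfloor>"
      have "real q * x < real q" using False x01 q by simp
      then have "i < q" using x01 by (auto simp: i_def nat_less_iff floor_less_iff)
      moreover have "x \<in> cell i" using x01 by (simp add: cell_iff i_def)
      ultimately show ?thesis using x by (auto simp: G_def D_def)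
    qed simp
  qed
  then have "measure lborel (B \<inter> E) \<le> measure lborel ({1} \<union> (\<Union>i\<in>G \<union> D. cell i \<inter> E))"
    by (rule measure_mono_fmeasurable)
       (use Eb Bb fin in \<open>auto simp: cell_def intro!: bounded_borel_fmeasurable sets.finite_UN bounded_Int bounded_UN\<close>)
  also have "\<dots> \<le> measure lborel {1::real} + measure lborel (\<Union>i\<in>G \<union> D. cell i \<inter> E)"
    by (rule measure_Un_le) (use Eb fin in \<open>auto simp: cell_def intro!: sets.finite_UN\<close>)
  also have "\<dots> \<le> 0 + (\<Sum>i\<in>G \<union> D. measure lborel (cell i \<inter> E))"
    by (intro add_mono measure_UNION_le) (use Eb fin in \<open>auto simp: cell_def\<close>)
  also have "\<dots> \<le> (\<Sum>i\<in>G \<union> D. 2 * e / real q)" unfolding add_0 by (intro sum_mono cellE)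
  also have "\<dots> = real (card (G \<union> D)) * (2 * e / real q)" by simp
  also have "\<dots> \<le> real (card G + card D) * (2 * e / real q)"
    using e by (intro mult_right_mono of_nat_mono card_Un_le) auto
  also have "\<dots> = 2 * e * (real (card G) / real q + real (card D) / real q)"
    by (simp add: field_simps add_divide_distrib)
  also have "\<dots> \<le> 2 * e * (measure lborel B + 2 * real (card F) / real q)"
    using e card_G card_D by (intro mult_left_mono add_mono divide_right_mono) auto
  finally show ?thesis by (simp add: E_def)
qed

section \<open>The removal process\<close>

text \<open>The range consists of \<open>3 * a\<close> dyadic blocks, each contributing at most
  \<open>C/a\<close>. Thus the ends of the blocks of the removal may grow by a fixed power.\<close>

lemma sum_blocks_le:
  fixes w :: "nat \<Rightarrow> real" and a :: nat
  assumes w: "\<And>k. k \<ge> 1 \<Longrightarrow> (\<Sum>q\<in>{2^k..<2^(k+1)}. w q) \<le> C / real k"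
    and "C \<ge> 0" "a \<ge> 1"
  shows "(\<Sum>q\<in>{2^a..<2^(4*a)}. w q) \<le> 3 * C"
proof -
  have "(\<Sum>q\<in>{2^a..<2^(a+m)}. w q) \<le> real m * (C / real a)" for m
  proof (induction m)
    case (Suc m)
    have "(\<Sum>q\<in>{2^a..<2^(a + Suc m)}. w q)
        = (\<Sum>q\<in>{2^a..<2^(a+m)}. w q) + (\<Sum>q\<in>{2^(a+m)..<2^(a+m+1)}. w q)"
      by (subst sum.atLeastLessThan_concat) (auto intro!: power_increasing)
    also have "(\<Sum>q\<in>{2^(a+m)..<2^(a+m+1)}. w q) \<le> C / real (a + m)" using assms by (intro w) auto
    also have "C / real (a + m) \<le> C / real a" using assms by (intro divide_left_mono) auto
    finally show ?case using Suc by (simp add: algebra_simps add_divide_distrib)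
  qed simp
  from this[of "3 * a"] show ?thesis using assms by simp
qed

text \<open>The balls with centres \<open>x i\<close> and radii \<open>r i\<close> are those of the
  hypothetical cover. By \<open>r_small\<close>, none of them has been removed yet at stage
  \<open>N0\<close>.\<close>

locale removal =
  fixes w :: "nat \<Rightarrow> real" and x r :: "nat \<Rightarrow> real" and s :: real and N0 :: nat
  assumes w_nonneg: "\<And>q. 0 \<le> w q"
    and s: "0 < s" "s < 1"
    and r_pos: "\<And>i. 0 < r i" and r_small: "\<And>i. r i < 1 / real N0"
    and r_sum: "\<And>I. finite I \<Longrightarrow> (\<Sum>i\<in>I. r i powr s) \<le> 1"
    and N0: "N0 \<ge> 1"
begin

text \<open>Balls of radius at least \<open>1/N\<close> go together with the denominators
  \<open>q < N\<close>, so that \<open>O(N^2)\<close> intervals are removed by stage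
  \<open>N\<close>. All of them are open, which keeps the remainder compact.\<close>

definition survivors :: "nat \<Rightarrow> real set" where
  "survivors N = {0..1} - (\<Union>q\<in>{N0..<N}. {\<beta>. dist_nint (real q * \<beta>) < w q})
            - (\<Union>i\<in>{i. 1 / real N \<le> r i}. ball (x i) (r i))"

lemma survivors_N0: "survivors N0 = {0..1}"
  using r_small by (auto simp: survivors_def not_le[symmetric])

lemma survivors_antimono:
  assumes "1 \<le> N" "N \<le> N'"
  shows "survivors N' \<subseteq> survivors N"
proof -
  have "1 / real N' \<le> 1 / real N" using assms by (simp add: frac_le)
  then have "{i. 1 / real N \<le> r i} \<subseteq> {i. 1 / real N' \<le> r i}" by (auto intro: order_trans)
  moreover have "{N0..<N} \<subseteq> {N0..<N'}" using assms by auto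
  ultimately show ?thesis unfolding survivors_def by (intro Diff_mono UN_mono order_refl)
qed

lemma compact_survivors: "compact (survivors N)"
  unfolding survivors_def by (intro compact_diff open_UN ballI open_dist_nint_less open_ball) auto

lemma survivors_fmeasurable: "survivors N \<in> fmeasurable lborel"
  using compact_survivors fmeasurable_compact by blast

text \<open>As \<open>s < 1\<close>, each of these radii has \<open>s\<close>-th power at least
  \<open>1/N\<close>, and the powers sum to at most 1.\<close>

lemma card_large_radii:
  assumes "N \<ge> 1"
  shows "finite {i. 1 / real N \<le> r i} \<and> card {i. 1 / real N \<le> r i} \<le> N"
proof (rule finite_if_finite_subsets_card_bdd)
  fix G assume G: "G \<subseteq> {i. 1 / real N \<le> r i}" "finite G"
  have "real (card G) * (1 / real N) \<le> (\<Sum>i\<in>G. r i powr s)"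
  proof -
    have "1 / real N \<le> r i powr s" if "i \<in> G" for i
    proof -
      have "1 / real N = (1 / real N) powr 1" using assms by simp
      also have "\<dots> \<le> (1 / real N) powr s" using s assms by (intro powr_mono') auto
      also have "\<dots> \<le> r i powr s" using s that G by (intro powr_mono2) auto
      finally show ?thesis .
    qed
    then show ?thesis using sum_bounded_below[of G "1 / real N" "\<lambda>i. r i powr s"] by simp
  qed
  also have "\<dots> \<le> 1" using r_sum G by simp
  finally show "card G \<le> N" using assms by (simp add: field_simps)
qed

text \<open>At most \<open>N^2\<close> intervals come from the pairs \<open>(q, p)\<close> with
  \<open>p \<le> q < N\<close>, and at most \<open>N\<close> from the balls.\<close>

lemma survivors_eq_Diff_intervals:
  assumes "N \<ge> 1"
  obtains F where "finite F" "card F \<le> 2 * N\<^sup>2" "survivors N = {0..1} - (\<Union>(a,b)\<in>F. {a<..<b})"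
proof -
  define S where "S = (SIGMA q:{N0..<N}. {0..q})"
  define f where "f = (\<lambda>(q,p). ((real p - w q) / real q, (real p + w q) / real q))"
  define g where "g i = (x i - r i, x i + r i)" for i
  let ?T = "{i. 1 / real N \<le> r i}"
  have S: "S \<subseteq> {..<N} \<times> {..<N}" by (auto simp: S_def)
  then have finS: "finite S" by (rule finite_subset) auto
  have "card S \<le> N\<^sup>2" using card_mono[OF _ S] by (simp add: power2_eq_square)
  moreover have "N \<le> N\<^sup>2" using assms by (simp add: power2_eq_square)
  moreover have "card (f ` S \<union> g ` ?T) \<le> card S + card ?T"
    using card_Un_le[of "f ` S" "g ` ?T"] card_image_le[OF finS, of f]
      card_image_le[of ?T g] card_large_radii[OF assms] by linarith
  ultimately have "card (f ` S \<union> g ` ?T) \<le> 2 * N\<^sup>2" using card_large_radii[OF assms] by linarith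
  moreover have "finite (f ` S \<union> g ` ?T)" using finS card_large_radii[OF assms] by simp
  moreover have "survivors N = {0..1} - (\<Union>(a,b)\<in>f ` S \<union> g ` ?T. {a<..<b})"
  proof -
    have key: "dist_nint (real q * \<beta>) < w q \<longleftrightarrow> (\<exists>p\<in>{0..q}. \<beta> \<in> {fst (f (q,p))<..<snd (f (q,p))})"
      if "\<beta> \<in> {0..1}" "q \<in> {N0..<N}" for \<beta> q
    proof -
      have q: "q > 0" using that N0 by simp
      have *: "\<beta> \<in> {fst (f (q,p))<..<snd (f (q,p))} \<longleftrightarrow> \<bar>real q * \<beta> - real p\<bar> < w q" for p
        using q by (auto simp: f_def field_simps abs_less_iff)
      have b: "0 \<le> real q * \<beta>" "real q * \<beta> \<le> real q" using that q by auto
      have "(\<exists>p::int. \<bar>real q * \<beta> - of_int p\<bar> < w q) \<longleftrightarrow> (\<exists>p\<in>{0..q}. \<bar>real q * \<beta> - real p\<bar> < w q)"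
      proof
        assume "\<exists>p::int. \<bar>real q * \<beta> - of_int p\<bar> < w q"
        then obtain p :: int where p: "\<bar>real q * \<beta> - of_int p\<bar> < w q" by blast
        \<comment> \<open>Since \<open>q * \<beta>\<close> lies between 0 and \<open>q\<close>,
          moving \<open>p\<close> into this range only brings it closer.\<close>
        show "\<exists>p\<in>{0..q}. \<bar>real q * \<beta> - real p\<bar> < w q"
        proof (cases "p < 0")
          case True
          then have "real_of_int p < 0" by simp
          then show ?thesis using p b by (intro bexI[of _ 0]) auto
        next
          case p0: False
          show ?thesis
          proof (cases "p > int q")
            case True
            then have "real_of_int p > real q" by linarith
            then show ?thesis using p b by (intro bexI[of _ q]) auto
          next
            case False
            then show ?thesis using p p0 by (intro bexI[of _ "nat p"]) auto
          qed
        qed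
      next
        assume "\<exists>p\<in>{0..q}. \<bar>real q * \<beta> - real p\<bar> < w q"
        then show "\<exists>p::int. \<bar>real q * \<beta> - of_int p\<bar> < w q" by (metis of_int_of_nat_eq)
      qed
      then show ?thesis by (simp only: * dist_nint_less_iff)
    qed
    have "(\<Union>(a,b)\<in>f ` S. {a<..<b})
        = (\<Union>q\<in>{N0..<N}. \<Union>p\<in>{0..q}. {fst (f (q,p))<..<snd (f (q,p))})"
      unfolding S_def by (simp add: split_beta UN_UN_split_split_eq[symmetric] Sigma_def)
    then have 1: "{0..1} \<inter> (\<Union>q\<in>{N0..<N}. {\<beta>. dist_nint (real q * \<beta>) < w q})
        = {0..1} \<inter> (\<Union>(a,b)\<in>f ` S. {a<..<b})"
      using key by (simp only: set_eq_iff Int_iff UN_iff mem_Collect_eq) blast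
    have 2: "(\<Union>i\<in>?T. ball (x i) (r i)) = (\<Union>(a,b)\<in>g ` ?T. {a<..<b})"
      by (auto simp: g_def ball_eq_greaterThanLessThan)
    have "survivors N = {0..1} - ({0..1} \<inter> (\<Union>q\<in>{N0..<N}. {\<beta>. dist_nint (real q * \<beta>) < w q}))
            - (\<Union>i\<in>?T. ball (x i) (r i))"
      unfolding survivors_def by blast
    then show ?thesis unfolding 1 2 by auto
  qed
  ultimately show thesis by (intro that[of "f ` S \<union> g ` ?T"])
qed

text \<open>In \<open>r = r powr (1 - s) * r powr s\<close> the first factor yields a negative power
  of \<open>N\<close>, because \<open>s < 1\<close>.\<close>

lemma sum_small_radii_le:
  assumes "N \<ge> 1" "finite I" "\<And>i. i \<in> I \<Longrightarrow> r i < 1 / real N"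
  shows "(\<Sum>i\<in>I. r i) \<le> (1 / real N) powr (1 - s)"
proof -
  have "(\<Sum>i\<in>I. r i) \<le> (\<Sum>i\<in>I. (1 / real N) powr (1 - s) * r i powr s)"
  proof (rule sum_mono)
    fix i assume i: "i \<in> I"
    have "r i = r i powr (1 - s) * r i powr s" using r_pos[of i] by (simp add: powr_add[symmetric])
    also have "\<dots> \<le> (1 / real N) powr (1 - s) * r i powr s"
      using s assms(3)[OF i] r_pos[of i] by (intro mult_right_mono powr_mono2) auto
    finally show "r i \<le> (1 / real N) powr (1 - s) * r i powr s" .
  qed
  also have "\<dots> = (1 / real N) powr (1 - s) * (\<Sum>i\<in>I. r i powr s)" by (simp add: sum_distrib_left)
  also have "\<dots> \<le> (1 / real N) powr (1 - s) * 1" using r_sum assms by (intro mult_left_mono) auto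
  finally show ?thesis by simp
qed

text \<open>Losses after stage \<open>N\<close> are measured inside the older set
  \<open>survivors N'\<close>. In the application its interval count \<open>card F\<close> is small
  against \<open>N\<close>, whereas the bound for \<open>survivors N\<close> itself is of order
  \<open>N^2\<close>, too large for denominators near \<open>N\<close>.\<close>

lemma measure_survivors_diff_le:
  assumes N: "N0 \<le> N'" "N' \<le> N" "N \<le> N''"
    and F: "finite F" "survivors N' = {0..1} - (\<Union>(a,b)\<in>F. {a<..<b})"
  shows "measure lborel (survivors N) - measure lborel (survivors N'')
    \<le> 2 * (\<Sum>q\<in>{N..<N''}. w q) * (measure lborel (survivors N') + 2 * real (card F) / real N)
       + 2 * (1 / real N) powr (1 - s)"
proof -
  have N1: "N \<ge> 1" using N N0 by simp
  define E where "E q = {\<beta>. dist_nint (real q * \<beta>) < w q}" for q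
  define T where "T = {i. 1 / real N'' \<le> r i \<and> r i < 1 / real N}"
  have finT: "finite T"
    by (rule finite_subset[of _ "{i. 1 / real N'' \<le> r i}"]) (use card_large_radii[of N''] N N1 in \<open>auto simp: T_def\<close>)
  have Eb: "E q \<in> sets lborel" for q using open_dist_nint_less by (simp add: E_def)
  have Bb: "survivors M \<in> sets lborel" for M using survivors_fmeasurable by (rule fmeasurableD)
  have sub: "survivors N \<subseteq> survivors N'' \<union> ((\<Union>q\<in>{N..<N''}. survivors N' \<inter> E q) \<union> (\<Union>i\<in>T. ball (x i) (r i)))"
  proof
    fix b assume b: "b \<in> survivors N"
    then have b': "b \<in> survivors N'" using survivors_antimono[of N' N] N N0 by auto
    show "b \<in> survivors N'' \<union> ((\<Union>q\<in>{N..<N''}. survivors N' \<inter> E q) \<union> (\<Union>i\<in>T. ball (x i) (r i)))"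
    proof (rule ccontr)
      assume n: "b \<notin> survivors N'' \<union> ((\<Union>q\<in>{N..<N''}. survivors N' \<inter> E q) \<union> (\<Union>i\<in>T. ball (x i) (r i)))"
      have "b \<notin> E q" if "q \<in> {N0..<N''}" for q
        using b b' n that by (cases "q < N") (auto simp: survivors_def E_def)
      moreover have "b \<notin> ball (x i) (r i)" if "1 / real N'' \<le> r i" for i
        using b n that by (cases "1 / real N \<le> r i") (auto simp: survivors_def T_def)
      ultimately have "b \<in> survivors N''" using b unfolding survivors_def E_def by auto
      then show False using n by blast
    qed
  qed
  have fm: "(\<Union>q\<in>{N..<N''}. survivors N' \<inter> E q) \<in> fmeasurable lborel" "(\<Union>i\<in>T. ball (x i) (r i)) \<in> fmeasurable lborel"
    using finT Eb
    by (auto simp del: UN_simps intro!: fmeasurable.finite_UN fmeasurable_Int_fmeasurable[OF survivors_fmeasurable])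
       (auto intro: bounded_borel_fmeasurable)
  have "measure lborel (survivors N) \<le> measure lborel (survivors N'' \<union> ((\<Union>q\<in>{N..<N''}. survivors N' \<inter> E q) \<union> (\<Union>i\<in>T. ball (x i) (r i))))"
    using fm survivors_fmeasurable by (intro measure_mono_fmeasurable sub Bb fmeasurable.Un)
  also have "\<dots> \<le> measure lborel (survivors N'') + measure lborel ((\<Union>q\<in>{N..<N''}. survivors N' \<inter> E q) \<union> (\<Union>i\<in>T. ball (x i) (r i)))"
    using fm by (intro measure_Un_le Bb sets.Un) auto
  also have "measure lborel ((\<Union>q\<in>{N..<N''}. survivors N' \<inter> E q) \<union> (\<Union>i\<in>T. ball (x i) (r i)))
    \<le> measure lborel (\<Union>q\<in>{N..<N''}. survivors N' \<inter> E q) + measure lborel (\<Union>i\<in>T. ball (x i) (r i))"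
    using fm by (intro measure_Un_le) auto
  also have "measure lborel (\<Union>q\<in>{N..<N''}. survivors N' \<inter> E q) \<le> (\<Sum>q\<in>{N..<N''}. measure lborel (survivors N' \<inter> E q))"
    using Eb Bb by (intro measure_UNION_le) auto
  also have "\<dots> \<le> (\<Sum>q\<in>{N..<N''}. 2 * w q * (measure lborel (survivors N') + 2 * real (card F) / real N))"
  proof (rule sum_mono)
    fix q assume q: "q \<in> {N..<N''}"
    have "measure lborel (survivors N' \<inter> E q) \<le> 2 * w q * (measure lborel (survivors N') + 2 * real (card F) / real q)"
      unfolding E_def using q N1 w_nonneg by (intro measure_dist_nint_less_Int_le F) auto
    also have "\<dots> \<le> 2 * w q * (measure lborel (survivors N') + 2 * real (card F) / real N)"
      using q N1 w_nonneg by (intro mult_left_mono add_left_mono divide_left_mono) auto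
    finally show "measure lborel (survivors N' \<inter> E q) \<le> 2 * w q * (measure lborel (survivors N') + 2 * real (card F) / real N)" .
  qed
  also have "\<dots> = 2 * (\<Sum>q\<in>{N..<N''}. w q) * (measure lborel (survivors N') + 2 * real (card F) / real N)"
    by (simp add: sum_distrib_left sum_distrib_right)
  also have "measure lborel (\<Union>i\<in>T. ball (x i) (r i)) \<le> (\<Sum>i\<in>T. measure lborel (ball (x i) (r i)))"
    using finT by (intro measure_UNION_le) auto
  also have "\<dots> = 2 * (\<Sum>i\<in>T. r i)"
    using r_pos by (simp add: ball_eq_greaterThanLessThan sum_distrib_left less_imp_le)
  also have "(\<Sum>i\<in>T. r i) \<le> (1 / real N) powr (1 - s)"
    using N1 finT by (intro sum_small_radii_le) (auto simp: T_def)
  finally show ?thesis by simp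
qed

end

section \<open>A point surviving at every scale\<close>

text \<open>The survivors at the scales \<open>n j\<close> are nested compact sets of measure at
  least \<open>2^-j\<close>, so they have a common point. The constants 96 and 3 make the losses to
  the sets around rationals and to the balls at most a quarter of the measure each.\<close>

lemma exists_point_avoiding_balls:
  fixes w x r :: "nat \<Rightarrow> real" and A :: nat
  assumes w: "\<And>q. 0 \<le> w q"
      "\<And>k. k \<ge> 1 \<Longrightarrow> (\<Sum>q\<in>{2^k..<2^(k+1)}. w q) \<le> 1 / (96 * real k)"
    and s: "0 < s" "s < 1" and A: "A \<ge> 1" "real A * (1 - s) \<ge> 3"
    and r: "\<And>i. 0 < r i" "\<And>i. r i < 1 / 2 ^ A" "\<And>I. finite I \<Longrightarrow> (\<Sum>i\<in>I. r i powr s) \<le> 1"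
  shows "\<exists>\<beta>. (\<forall>q\<ge>2 ^ A. w q \<le> dist_nint (real q * \<beta>)) \<and> (\<forall>i. \<beta> \<notin> ball (x i) (r i))"
proof -
  interpret removal w x r s "2 ^ A"
    using assms by unfold_locales auto
  define n :: "nat \<Rightarrow> nat" where "n j = 2 ^ (A * 4 ^ j)" for j
  define b where "b j = measure lborel (survivors (n j))" for j
  have j4: "j < 4 ^ j" for j :: nat by (induction j) auto
  have A4: "j < A * 4 ^ j" for j :: nat
    using j4[of j] A(1) by (metis less_le_trans mult.left_neutral mult_le_mono1)
  have n_ge: "j < n j" for j
    unfolding n_def using A4[of j] less_exp[of "A * 4 ^ j"] by (rule less_trans)
  have n_mono: "n i \<le> n j" if "i \<le> j" for i j
    using that A by (auto simp: n_def intro!: power_increasing)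
  have n_1: "1 \<le> n j" for j by (simp add: n_def)
  have n_0: "n 0 = 2 ^ A" by (simp add: n_def)
  have n_Suc: "real (n (Suc j)) = real (n j) ^ 4" for j
    by (simp add: n_def power_mult[symmetric] mult_ac)
  have Wle: "(\<Sum>q\<in>{n j..<n (Suc j)}. w q) \<le> 1/32" for j
  proof -
    have "(\<Sum>q\<in>{2^(A * 4^j)..<2^(4 * (A * 4^j))}. w q) \<le> 3 * (1/96)"
      using w A by (intro sum_blocks_le) auto
    then show ?thesis by (simp add: n_def mult_ac)
  qed
  have tail: "2 * (1 / real (n j)) powr (1 - s) \<le> (1/2) ^ j / 4" for j
  proof -
    \<comment> \<open>The aim is the exponent \<open>j + 3\<close>: its 3 absorbs the factor 2 and
      leaves the quarter.\<close>
    have "real j + 3 \<le> 3 * 4 ^ j" by (induction j) auto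
    also have "\<dots> \<le> real A * (1 - s) * 4 ^ j" using A by (intro mult_right_mono) auto
    finally have le: "real j + 3 \<le> real (A * 4 ^ j) * (1 - s)" by (simp add: mult_ac)
    have "1 / real (n j) = 2 powr (- real (A * 4 ^ j))"
      by (simp add: n_def powr_minus powr_realpow[symmetric] divide_inverse)
    then have "(1 / real (n j)) powr (1 - s) = 2 powr (- (real (A * 4 ^ j) * (1 - s)))"
      by (simp add: powr_powr)
    also have "\<dots> \<le> 2 powr (- (real j + 3))" using le by (intro powr_mono) auto
    also have "\<dots> = (1/2) ^ j / 8"
    proof -
      have "(2::real) powr (- (real j + 3)) = inverse (2 powr real (j + 3))"
        by (simp only: powr_minus of_nat_add of_nat_numeral)
      also have "\<dots> = inverse (2 ^ (j + 3))" by (subst powr_realpow) auto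
      finally show ?thesis by (simp add: power_add power_divide inverse_eq_divide)
    qed
    finally show ?thesis by simp
  qed
  have step: "b (Suc j) \<ge> b j / 2 \<and> b j \<ge> (1/2) ^ j" for j
  proof (induction j)
    case 0
    have b0: "b 0 = 1" using survivors_N0 by (simp add: b_def n_0)
    \<comment> \<open>Nothing has been removed yet, so \<open>[0,1]\<close> serves both as current
      and as older set, with \<open>F\<close> empty.\<close>
    have "b 0 - b (Suc 0) \<le> 2 * (\<Sum>q\<in>{n 0..<n (Suc 0)}. w q) * (b 0 + 2 * real (card ({} :: (real \<times> real) set)) / real (n 0))
        + 2 * (1 / real (n 0)) powr (1 - s)"
      unfolding b_def
      by (intro measure_survivors_diff_le) (use n_mono[of 0 1] in \<open>auto simp: n_0 survivors_N0\<close>)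
    also have "\<dots> \<le> 2 * (1/32) * 1 + (1/2)^0 / 4"
      using Wle[of 0] tail[of 0] b0 by simp
    finally show ?case using b0 by simp
  next
    case (Suc j)
    have bS: "b (Suc j) \<ge> (1/2) ^ Suc j" using Suc by simp
    obtain F where F: "finite F" "card F \<le> 2 * (n j)\<^sup>2" "survivors (n j) = {0..1} - (\<Union>(a,b)\<in>F. {a<..<b})"
      using survivors_eq_Diff_intervals[OF n_1] by blast
    have nj: "real (n j) > 0" using n_1[of j] by simp
    \<comment> \<open>At most \<open>2 * (n j)^2\<close> intervals meet denominators of size at
      least \<open>(n j)^4\<close>; the exponent 4 exceeds 2, so the boundary term decays.\<close>
    have "2 * real (card F) / real (n (Suc j)) \<le> 2 * real (2 * (n j)\<^sup>2) / real (n (Suc j))"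
      using F by (intro divide_right_mono mult_left_mono of_nat_mono) auto
    also have "\<dots> = 4 / (real (n j))\<^sup>2" using nj by (simp add: n_Suc power_numeral_reduce field_simps)
    also have "\<dots> \<le> (1/2) ^ j"
    proof -
      have "(2::real) ^ (j + 1) \<le> 2 ^ (A * 4 ^ j)" using A4[of j] by (intro power_increasing) auto
      then have 1: "2 ^ (j + 1) \<le> real (n j)" by (simp add: n_def)
      have "(2::real) ^ 1 \<le> 2 ^ (j + 1)" by (intro power_increasing) auto
      from order_trans[OF this 1] have "2 \<le> real (n j)" by simp
      then have "2 * 2 ^ (j + 1) \<le> real (n j) * real (n j)" using 1 by (intro mult_mono) auto
      then have "4 * 2 ^ j \<le> (real (n j))\<^sup>2" by (simp add: power2_eq_square)
      then show ?thesis using nj divide_left_mono[of "4 * 2 ^ j" "(real (n j))\<^sup>2" "4::real"]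
        by (simp add: power_divide)
    qed
    finally have M: "2 * real (card F) / real (n (Suc j)) \<le> (1/2) ^ j" .
    have "b (Suc j) - b (Suc (Suc j)) \<le>
        2 * (\<Sum>q\<in>{n (Suc j)..<n (Suc (Suc j))}. w q) * (b j + 2 * real (card F) / real (n (Suc j)))
        + 2 * (1 / real (n (Suc j))) powr (1 - s)"
      unfolding b_def using n_mono[of 0 j] by (intro measure_survivors_diff_le n_mono F) (auto simp: n_0)
    also have "\<dots> \<le> 2 * (1/32) * (b j + (1/2) ^ j) + (1/2) ^ Suc j / 4"
      using M Wle by (intro add_mono mult_mono tail) (auto simp: b_def sum_nonneg w)
    \<comment> \<open>By induction \<open>b j \<le> 2 * b (Suc j)\<close>, and \<open>bS\<close>
      gives \<open>(1/2)^j \<le> 2 * b (Suc j)\<close>. Hence both summands are at most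
      \<open>b (Suc j) / 4\<close>.\<close>
    finally have "b (Suc j) - b (Suc (Suc j)) \<le> b (Suc j) / 2"
      using conjunct1[OF Suc] bS unfolding power_Suc by argo
    then show ?case using bS by simp
  qed
  have "\<Inter>(range (\<lambda>j. survivors (n j))) \<noteq> {}"
  proof (rule compact_nest)
    show "survivors (n j) \<noteq> {}" for j
    proof
      assume "survivors (n j) = {}"
      then have "b j = 0" by (simp add: b_def)
      moreover have "(1/2::real) ^ j > 0" by simp
      ultimately show False using step[of j] by linarith
    qed
  qed (use compact_survivors survivors_antimono n_mono n_1 in auto)
  then obtain \<beta> where \<beta>: "\<And>j. \<beta> \<in> survivors (n j)" by blast
  show ?thesis
  proof (intro exI[of _ \<beta>] conjI allI impI)
    fix q :: nat assume "q \<ge> 2 ^ A"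
    then show "w q \<le> dist_nint (real q * \<beta>)" using \<beta>[of q] n_ge[of q] by (force simp: survivors_def)
  next
    fix i
    obtain j where j: "1 / r i < real j" using reals_Archimedean2 by blast
    then have "1 / r i < real (n j)" using n_ge[of j] by linarith
    then have "1 / real (n j) \<le> r i" using r(1)[of i] n_1[of j] by (simp add: field_simps)
    then show "\<beta> \<notin> ball (x i) (r i)" using \<beta>[of j] by (force simp: survivors_def)
  qed
qed

section \<open>Hausdorff measure and covers\<close>

text \<open>Each nonempty set of a cover lies in the open ball around any of its points with radius
  slightly larger than its diameter.\<close>

lemma hausdorff_measure_zero_imp_ball_cover:
  fixes E :: "'a::metric_space set"
  assumes E: "hausdorff_measure s E = 0" and s: "s > 0" and e: "e > 0"
  obtains r :: "nat \<Rightarrow> real" and x :: "nat \<Rightarrow> 'a"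
  where "\<And>i. 0 < r i" "E \<subseteq> (\<Union>i. ball (x i) (r i))"
    "\<And>I. finite I \<Longrightarrow> (\<Sum>i\<in>I. r i powr s) \<le> e"
proof -
  have "hausdorff_pre s 1 E \<le> hausdorff_measure s E"
    unfolding hausdorff_measure_def by (rule SUP_upper) simp
  also have "\<dots> < ennreal (e / 2)" using E e by simp
  finally obtain U :: "nat \<Rightarrow> 'a set" where U: "E \<subseteq> (\<Union>i. U i)" "\<And>i. bounded (U i)"
    "(\<Sum>i. ennreal (diameter (U i) powr s)) < ennreal (e / 2)"
    unfolding hausdorff_pre_def by (auto simp: INF_less_iff)
  define f where "f i = diameter (U i) powr s" for i
  \<comment> \<open>The slack in the \<open>s\<close>-th powers sums to \<open>e/2\<close> and makes
    \<open>r i\<close> positive even when \<open>U i\<close> has diameter 0.\<close>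
  define g where "g i = f i + e * (1/2) ^ (i + 2)" for i
  define r where "r i = g i powr (1 / s)" for i
  \<comment> \<open>For empty \<open>U i\<close> the centre is an arbitrary point, which is harmless
    since such a set covers nothing.\<close>
  define x where "x i = (SOME y. y \<in> U i)" for i
  have f0: "f i \<ge> 0" for i by (simp add: f_def)
  have fg: "f i < g i" for i using e by (simp add: g_def)
  have g0: "g i > 0" for i using fg[of i] f0[of i] by linarith
  have rs: "r i powr s = g i" for i using g0[of i] s by (simp add: r_def powr_powr)
  have diam: "diameter (U i) < r i" for i
  proof -
    have "diameter (U i) = f i powr (1 / s)"
      using diameter_ge_0[OF U(2)[of i]] s by (simp add: f_def powr_powr)
    also have "\<dots> < r i" unfolding r_def using s f0 fg by (intro powr_less_mono2) auto
    finally show ?thesis .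
  qed
  show thesis
  proof
    show "0 < r i" for i using g0[of i] by (simp add: r_def)
    show "E \<subseteq> (\<Union>i. ball (x i) (r i))"
    proof
      fix y assume "y \<in> E"
      then obtain i where i: "y \<in> U i" using U(1) by auto
      then have "x i \<in> U i" unfolding x_def by (rule someI)
      then have "dist (x i) y \<le> diameter (U i)" using U(2) i by (intro diameter_bounded_bound)
      then show "y \<in> (\<Union>i. ball (x i) (r i))" using diam[of i] by (auto intro: exI[of _ i])
    qed
    fix I :: "nat set" assume I: "finite I"
    have "ennreal (\<Sum>i\<in>I. f i) = (\<Sum>i\<in>I. ennreal (f i))" using f0 by (simp add: sum_ennreal)
    also have "\<dots> \<le> (\<Sum>i. ennreal (f i))" using I by (intro sum_le_suminf) auto
    also have "\<dots> \<le> ennreal (e / 2)" using U(3) by (simp add: f_def)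
    finally have F: "(\<Sum>i\<in>I. f i) \<le> e / 2" using e by (simp add: ennreal_le_iff)
    have "(\<Sum>i\<in>I. (1/2::real) ^ i) \<le> (\<Sum>i. (1/2) ^ i)"
      using I by (intro sum_le_suminf summable_geometric) auto
    also have "\<dots> = 2" by (subst suminf_geometric) auto
    finally have "e / 4 * (\<Sum>i\<in>I. (1/2::real) ^ i) \<le> e / 4 * 2"
      using e by (intro mult_left_mono) auto
    moreover have "(\<Sum>i\<in>I. e * (1/2) ^ (i + 2)) = e / 4 * (\<Sum>i\<in>I. (1/2::real) ^ i)"
      by (simp add: sum_distrib_left power_add mult_ac)
    ultimately have G: "(\<Sum>i\<in>I. e * (1/2) ^ (i + 2)) \<le> e / 2" by simp
    show "(\<Sum>i\<in>I. r i powr s) \<le> e" using F G unfolding rs g_def sum.distrib by linarith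
  qed
qed

text \<open>Intervals of lengths proportional to \<open>1/n\<close> can cover the line, while the sum of the
  \<open>s\<close>-th powers of their lengths converges.\<close>

lemma hausdorff_measure_real_eq_0:
  fixes E :: "real set"
  assumes s: "s > 1"
  shows "hausdorff_measure s E = 0"
proof -
  define Z where "Z = (\<Sum>i. real (Suc i) powr (-s))"
  have sm: "summable (\<lambda>i. real (Suc i) powr (-s))"
    using s by (subst summable_Suc_iff) (simp add: summable_real_powr_iff)
  have "hausdorff_pre s d E \<le> 0" if d: "d > 0" for d
  proof -
    have le: "hausdorff_pre s d E \<le> ennreal ((2 * h) powr s * Z)" if h: "0 < h" "h < d" for h
    proof -
      \<comment> \<open>\<open>J k\<close> has length \<open>h / (k + 1)\<close>, and the divergence
        of the harmonic series makes these intervals cover the half-line. Even indices of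
        \<open>U\<close> give \<open>J\<close> itself, odd ones its reflection.\<close>
      define J where "J k = {h * harm k..h * harm (Suc k)}" for k
      define U where "U i = (\<lambda>x. (-1) ^ i * x) ` J (i div 2)" for i :: nat
      have diam: "bounded (U i) \<and> diameter (U i) \<le> 2 * h / real (Suc i) \<and> diameter (U i) \<le> d" for i
      proof -
        have len: "\<bar>a - b\<bar> \<le> h / real (Suc (i div 2))" if "a \<in> J (i div 2)" "b \<in> J (i div 2)" for a b
        proof -
          have "h * harm (Suc (i div 2)) = h * harm (i div 2) + h / real (Suc (i div 2))"
            by (simp only: harm_Suc divide_inverse distrib_left)
          then show ?thesis using that unfolding J_def atLeastAtMost_iff by linarith
        qed
        have "diameter (U i) \<le> h / real (Suc (i div 2))"
        proof (rule diameter_le)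
          show "U i \<noteq> {} \<or> 0 \<le> h / real (Suc (i div 2))" using h by simp
          fix a b assume "a \<in> U i" "b \<in> U i"
          then obtain a' b' where ab: "a = (-1) ^ i * a'" "b = (-1) ^ i * b'" "a' \<in> J (i div 2)" "b' \<in> J (i div 2)"
            by (auto simp: U_def)
          then have "norm (a - b) = \<bar>a' - b'\<bar>"
            by (simp add: right_diff_distrib[symmetric] abs_mult power_abs)
          then show "norm (a - b) \<le> h / real (Suc (i div 2))" using len ab by simp
        qed
        moreover have "h / real (Suc (i div 2)) \<le> h / (real (Suc i) / 2)"
        proof (rule divide_left_mono)
          have "Suc i \<le> 2 * Suc (i div 2)" by simp
          then have "real (Suc i) \<le> real (2 * Suc (i div 2))" by (rule of_nat_mono)
          then show "real (Suc i) / 2 \<le> real (Suc (i div 2))" by simp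
        qed (use h in auto)
        moreover have "h / real (Suc (i div 2)) \<le> h / 1" using h by (intro divide_left_mono) auto
        moreover have "bounded (U i)"
          unfolding U_def J_def by (intro bounded_linear_image bounded_closed_interval bounded_linear_mult_right)
        ultimately show ?thesis using h by (simp add: mult.commute)
      qed
      have cover: "\<exists>k. y \<in> J k" if "y \<ge> 0" for y
      proof -
        have "\<exists>k. y < h * harm k"
        proof -
          have "eventually (\<lambda>k. y / h < harm k) sequentially"
            using harm_at_top by (simp add: filterlim_at_top_dense)
          then obtain k where "y / h < harm k" by (auto simp: eventually_sequentially)
          then show ?thesis using h by (auto simp: field_simps)
        qed
        then obtain k where k: "y < h * harm k" "\<And>j. j < k \<Longrightarrow> \<not> y < h * harm j"
          using exists_least_iff[of "\<lambda>k. y < h * harm k"] by blast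
        have "k \<noteq> 0"
        proof
          assume "k = 0"
          then show False using k(1) that by (simp add: harm_def)
        qed
        then obtain j where "k = Suc j" by (cases k) auto
        then have "y \<in> J j" using k(1) k(2)[of j] by (simp add: J_def)
        then show ?thesis by blast
      qed
      have "E \<subseteq> (\<Union>i. U i)"
      proof
        fix y
        obtain k where k: "\<bar>y\<bar> \<in> J k" using cover[of "\<bar>y\<bar>"] by auto
        show "y \<in> (\<Union>i. U i)"
        proof (cases "y \<ge> 0")
          case True
          then have "y \<in> U (2 * k)" using k by (simp add: U_def)
          then show ?thesis by blast
        next
          case False
          then have "y \<in> U (2 * k + 1)" using k by (auto simp: U_def intro!: image_eqI[of _ _ "-y"])
          then show ?thesis by blast
        qed
      qed
      then have "hausdorff_pre s d E \<le> (\<Sum>i. ennreal (diameter (U i) powr s))"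
        unfolding hausdorff_pre_def using diam by (intro INF_lower) auto
      also have "\<dots> \<le> (\<Sum>i. ennreal ((2 * h) powr s * real (Suc i) powr (-s)))"
      proof (intro suminf_le ennreal_leI)
        fix i
        have "diameter (U i) powr s \<le> (2 * h / real (Suc i)) powr s"
          using diam[of i] s diameter_ge_0[of "U i"] by (intro powr_mono2) auto
        also have "\<dots> = (2 * h) powr s * real (Suc i) powr (-s)"
          using h by (subst powr_divide) (auto simp: powr_minus divide_inverse)
        finally show "diameter (U i) powr s \<le> (2 * h) powr s * real (Suc i) powr (-s)" .
      qed auto
      also have "\<dots> = ennreal (\<Sum>i. (2 * h) powr s * real (Suc i) powr (-s))"
        using sm by (intro suminf_ennreal2 summable_mult) auto
      also have "(\<Sum>i. (2 * h) powr s * real (Suc i) powr (-s)) = (2 * h) powr s * Z"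
        unfolding Z_def by (rule suminf_mult[OF sm])
      finally show ?thesis .
    qed
    \<comment> \<open>The scale \<open>h\<close> was arbitrary below \<open>d\<close> and
      \<open>Z\<close> does not depend on it, so \<open>h\<close> may tend to 0.\<close>
    have "((\<lambda>h. (2 * h) powr s * Z) \<longlongrightarrow> (2 * 0) powr s * Z) (at_right 0)"
      using s by (intro tendsto_intros tendsto_powr')
         (auto simp: eventually_at_right_less intro!: eventually_mono[OF eventually_at_right_less[of "0::real"]])
    then have "((\<lambda>h. ennreal ((2 * h) powr s * Z)) \<longlongrightarrow> ennreal ((2 * 0) powr s * Z)) (at_right 0)"
      by (rule tendsto_ennrealI)
    then have "((\<lambda>h. ennreal ((2 * h) powr s * Z)) \<longlongrightarrow> 0) (at_right 0)" by simp
    moreover have "eventually (\<lambda>h. hausdorff_pre s d E \<le> ennreal ((2 * h) powr s * Z)) (at_right 0)"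
      using eventually_at_right_real[OF d] by eventually_elim (auto intro: le)
    ultimately show ?thesis by (rule tendsto_lowerbound) simp
  qed
  then show ?thesis unfolding hausdorff_measure_def
    by (intro antisym SUP_least) auto
qed

section \<open>The dimension of the set\<close>

lemma hausdorff_measure_littlewood_set_nonzero:
  assumes \<alpha>: "badly_approximable \<alpha>" and s: "0 < s" "s < 1"
  shows "hausdorff_measure s {\<beta>::real. liminf (\<lambda>q::nat. ereal (real q * (ln (real q))\<^sup>2
            * dist_nint (real q * \<alpha>) * dist_nint (real q * \<beta>))) > 0} \<noteq> 0"
    (is "hausdorff_measure s ?E \<noteq> 0")
proof
  define E where "E = ?E"
  assume "hausdorff_measure s ?E = 0"
  then have E0: "hausdorff_measure s E = 0" by (simp only: E_def)
  define X where "X q = real q * (ln (real q))\<^sup>2 * dist_nint (real q * \<alpha>)" for q :: nat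
  obtain C where C: "C > 0" "\<And>k. k \<ge> 1 \<Longrightarrow> (\<Sum>q\<in>{2^k..<2^(k+1)}. 1 / X q) \<le> C / real k"
    using dyadic_sum_littlewood_weight_le[OF \<alpha>] unfolding X_def by blast
  obtain c where c: "c > 0" "\<And>q::nat. q \<ge> 1 \<Longrightarrow> c \<le> real q * dist_nint (real q * \<alpha>)"
    using badly_approximable_lower_bound[OF \<alpha>] by blast
  have X0: "X q \<ge> 0" for q by (simp add: X_def)
  have X_pos: "X q > 0" if "q \<ge> 2" for q
  proof -
    have "dist_nint (real q * \<alpha>) \<noteq> 0" using c(1) c(2)[of q] that by auto
    then have "dist_nint (real q * \<alpha>) > 0" by (simp add: less_le)
    moreover have "ln (real q) > 0" using that by (intro ln_gt_zero) auto
    ultimately show ?thesis using that by (simp add: X_def)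
  qed
  \<comment> \<open>The factor normalises the dyadic sums to \<open>1 / (96 * k)\<close>. At
    \<open>q = 0\<close> and \<open>q = 1\<close> division by zero gives
    \<open>w q = 0\<close>.\<close>
  define w where "w q = 1 / (96 * C) * (1 / X q)" for q
  obtain A :: nat where A: "max 1 (3 / (1 - s)) \<le> real A" using real_arch_simple by blast
  have A1: "A \<ge> 1" using A by simp
  have A2: "real A * (1 - s) \<ge> 3" using A s by (simp add: field_simps)
  \<comment> \<open>A total below \<open>2^-A\<close> forces small radii, as
    \<open>r i \<le> r i powr s \<le> e\<close> once \<open>r i \<le> 1\<close>.\<close>
  define e :: real where "e = 1 / 2 ^ (A + 1)"
  have e: "e > 0" "e < 1 / 2 ^ A" "e \<le> 1"
    using one_le_power[of "2::real" "A + 1"] by (auto simp: e_def field_simps)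
  obtain r x :: "nat \<Rightarrow> real" where r: "\<And>i. 0 < r i" "E \<subseteq> (\<Union>i. ball (x i) (r i))"
    "\<And>I. finite I \<Longrightarrow> (\<Sum>i\<in>I. r i powr s) \<le> e"
    by (rule hausdorff_measure_zero_imp_ball_cover[OF E0 s(1) e(1)]) blast
  have r_small: "r i < 1 / 2 ^ A" for i
  proof -
    have rs: "r i powr s \<le> e" using r(3)[of "{i}"] by simp
    have "r i \<le> 1"
    proof (rule ccontr)
      assume "\<not> r i \<le> 1"
      then have "r i powr s > 1" using s by (simp add: gr_one_powr)
      then show False using rs e by simp
    qed
    then have "r i powr 1 \<le> r i powr s" using s r(1)[of i] by (intro powr_mono') auto
    then show ?thesis using rs e r(1)[of i] by simp
  qed
  have w1: "(\<Sum>q\<in>{2^k..<2^(k+1)}. w q) \<le> 1 / (96 * real k)" if "k \<ge> 1" for k :: nat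
  proof -
    have "(\<Sum>q\<in>{2^k..<2^(k+1)}. w q) = 1 / (96 * C) * (\<Sum>q\<in>{2^k..<2^(k+1)}. 1 / X q)"
      unfolding w_def by (simp only: sum_distrib_left)
    also have "\<dots> \<le> 1 / (96 * C) * (C / real k)" using C that by (intro mult_left_mono) auto
    finally show ?thesis using C(1) by simp
  qed
  have r1: "(\<Sum>i\<in>I. r i powr s) \<le> 1" if "finite I" for I using r(3)[OF that] e by simp
  have w0: "0 \<le> w q" for q using C X0 by (simp add: w_def)
  obtain \<beta> where \<beta>: "\<forall>q\<ge>2 ^ A. w q \<le> dist_nint (real q * \<beta>)" "\<forall>i. \<beta> \<notin> ball (x i) (r i)"
    using exists_point_avoiding_balls[OF w0 w1 s A1 A2 r(1) r_small r1, of x] by metis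
  \<comment> \<open>For \<open>q \<ge> 2^A\<close> the product \<open>X q * w q\<close> is the
    constant \<open>1 / (96 * C)\<close>, which therefore bounds the liminf from below.\<close>
  have "eventually (\<lambda>q. ereal (1 / (96 * C)) \<le> ereal (X q * dist_nint (real q * \<beta>))) sequentially"
  proof (rule eventually_sequentiallyI)
    fix q :: nat assume q: "q \<ge> 2 ^ A"
    have "(2::nat) ^ 1 \<le> 2 ^ A" using A1 by (intro power_increasing) auto
    then have "X q > 0" using q by (intro X_pos) simp
    then have "1 / (96 * C) = X q * w q" by (simp add: w_def)
    also have "\<dots> \<le> X q * dist_nint (real q * \<beta>)" using \<beta>(1) q X0 by (intro mult_left_mono) auto
    finally show "ereal (1 / (96 * C)) \<le> ereal (X q * dist_nint (real q * \<beta>))" by simp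
  qed
  then have "ereal (1 / (96 * C)) \<le> liminf (\<lambda>q. ereal (X q * dist_nint (real q * \<beta>)))"
    by (rule Liminf_bounded)
  moreover have "0 < ereal (1 / (96 * C))" using C by simp
  ultimately have "\<beta> \<in> E" unfolding X_def E_def mem_Collect_eq by (rule less_le_trans[rotated])
  then show False using r(2) \<beta>(2) by blast
qed

theorem theorem1:
  fixes \<alpha> :: real
  assumes "badly_approximable \<alpha>"
  shows "hausdorff_dim {\<beta>::real. liminf (\<lambda>q::nat. ereal (real q * (ln (real q))\<^sup>2
            * dist_nint (real q * \<alpha>) * dist_nint (real q * \<beta>))) > 0} = 1"
  unfolding hausdorff_dim_def
proof (rule antisym)
  let ?E = "{\<beta>::real. liminf (\<lambda>q::nat. ereal (real q * (ln (real q))\<^sup>2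
            * dist_nint (real q * \<alpha>) * dist_nint (real q * \<beta>))) > 0}"
  let ?S = "{s. 0 < s \<and> hausdorff_measure s ?E = 0}"
  have S: "s \<in> ?S" if "s > 1" for s using that hausdorff_measure_real_eq_0 by simp
  have bdd: "bdd_below ?S" by (rule bdd_belowI[of _ 0]) auto
  show "Inf ?S \<le> 1"
  proof (rule dense_ge)
    show "Inf ?S \<le> s" if "1 < s" for s by (rule cInf_lower[OF S[OF that] bdd])
  qed
  have "1 \<le> s" if "s \<in> ?S" for s
    using that hausdorff_measure_littlewood_set_nonzero[OF assms, of s] by fastforce
  \<comment> \<open>A member is exhibited so that \<open>Inf ?S\<close> is a genuine greatest lower
    bound.\<close>
  moreover have "2 \<in> ?S" by (rule S) simp
  then have "?S \<noteq> {}" by blast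
  ultimately show "1 \<le> Inf ?S" by (intro cInf_greatest)
qed

end
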